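(* Let $f:\mathcal H\to\mathbb R$ be twice continuously differentiable and $\mu$-strongly convex with $\mu>0$, let $x^*$ be its unique minimizer, and let $\Delta_1,\Delta_2$ be constants satisfying $$0<\frac{\sqrt{\mu}}{2}\Delta_2<\Delta_1 .$$ Let $X:[0,\infty)\to\mathcal H$, $t\mapsto X_t$, be a solution of $$\ddot{X_t}+2\sqrt{\mu}\,\dot{X_t}+(1+\Delta_1)\nabla f(X_t)+\Delta_2\nabla^2 f(X_t)\dot{X_t}=0 ,$$ and define $$\mathcal{E}(t)= e^{\sqrt{\mu}t}\Big((1+\Delta_1)(f(X_t)-f(x^* ))+\tfrac{1}{2}\|\dot{X_t}+\sqrt{\mu}(X_t-x^* )+\Delta_2\nabla f(X_t)\|^2\Big).$$ Then for all $t\ge0$, $$\frac{\mathrm d\mathcal{E}(t)}{\mathrm dt}\le -c_1\mathcal{E}(t),\qquad c_1=\min\left\{\frac{2\mu\Delta_2}{1+\Delta_1+3\mu\Delta_2^2}\Big(\Delta_1-\frac{\sqrt{\mu}}{2}\Delta_2\Big),\ \frac{\sqrt{\mu}}{3},\ \frac{\sqrt{\mu}}{3}\Delta_1\right\}>0 .$$ Thus, for all $t\ge 0$, $$f(X_t)-f(x^* )\le\frac{1}{1+\Delta_1}e^{-(\sqrt{\mu}+c_1)t}\mathcal{E}(0).$$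
   Context: $\mathcal H$ is a real finite-dimensional Hilbert space with inner product $\langle\cdot,\cdot\rangle$ and induced norm $\|\cdot\|$. A continuously differentiable $f$ is $\mu$-strongly convex if $f(y)-f(x)\ge\langle\nabla f(x),y-x\rangle+\frac{\mu}{2}\|y-x\|^2$ for all $x,y\in\mathcal H$. $\dot{X_t}$ and $\ddot{X_t}$ denote the first and second derivatives of $t\mapsto X_t$; $\nabla^2 f$ is the Hessian. *)

theory Defs
  imports "HOL-Analysis.Analysis"
begin

(* The definitions work in real inner product spaces. A Hilbert space of finite dimension is
   obtained by adding the hypothesis that a finite set spans the space; completeness is then
   automatic. Class euclidean_space would exclude the space of dimension 0. *)

definition gradient :: "('a::real_inner \<Rightarrow> real) \<Rightarrow> 'a \<Rightarrow> 'a" where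
  "gradient f x = (THE g. GDERIV f x :> g)"

definition hessian :: "('a::real_inner \<Rightarrow> real) \<Rightarrow> 'a \<Rightarrow> 'a \<Rightarrow>\<^sub>L 'a" where
  "hessian f x = (THE H. (gradient f has_derivative blinfun_apply H) (at x))"

(* In finite dimension every Frechet derivative has a Riesz representative, and the Riesz map is
   isometric, so this is ordinary continuous differentiability. *)
definition continuously_differentiable :: "('a::real_inner \<Rightarrow> real) \<Rightarrow> bool" where
  "continuously_differentiable f \<longleftrightarrow>
     (\<forall>x. \<exists>g. GDERIV f x :> g) \<and> continuous_on UNIV (gradient f)"

definition twice_continuously_differentiable :: "('a::real_inner \<Rightarrow> real) \<Rightarrow> bool" where
  "twice_continuously_differentiable f \<longleftrightarrow>
     continuously_differentiable f \<and>
     (\<forall>x. gradient f differentiable (at x)) \<and> continuous_on UNIV (hessian f)"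

definition strongly_convex :: "real \<Rightarrow> ('a::real_inner \<Rightarrow> real) \<Rightarrow> bool" where
  "strongly_convex \<mu> f \<longleftrightarrow>
     continuously_differentiable f \<and>
     (\<forall>x y. f y - f x \<ge> gradient f x \<bullet> (y - x) + \<mu> / 2 * (norm (y - x))\<^sup>2)"

(* Derivative of a curve on [0, \<infinity>): one-sided at t = 0, two-sided for t > 0. *)
definition curve_deriv :: "(real \<Rightarrow> 'a::real_normed_vector) \<Rightarrow> real \<Rightarrow> 'a" where
  "curve_deriv X t = vector_derivative X (at t within {0..})"

definition hessian_damped_solution ::
    "real \<Rightarrow> real \<Rightarrow> real \<Rightarrow> ('a::real_inner \<Rightarrow> real) \<Rightarrow> (real \<Rightarrow> 'a) \<Rightarrow> bool" where
  "hessian_damped_solution \<mu> \<Delta>1 \<Delta>2 f X \<longleftrightarrow>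
     (\<forall>t\<ge>0. X differentiable (at t within {0..}) \<and>
            curve_deriv X differentiable (at t within {0..}) \<and>
            curve_deriv (curve_deriv X) t + (2 * sqrt \<mu>) *\<^sub>R curve_deriv X t
              + (1 + \<Delta>1) *\<^sub>R gradient f (X t)
              + \<Delta>2 *\<^sub>R blinfun_apply (hessian f (X t)) (curve_deriv X t) = 0)"

definition energy ::
    "real \<Rightarrow> real \<Rightarrow> real \<Rightarrow> ('a::real_inner \<Rightarrow> real) \<Rightarrow> 'a \<Rightarrow> (real \<Rightarrow> 'a) \<Rightarrow> real \<Rightarrow> real" where
  "energy \<mu> \<Delta>1 \<Delta>2 f xs X t =
     exp (sqrt \<mu> * t) *
       ((1 + \<Delta>1) * (f (X t) - f xs)
        + 1 / 2 * (norm (curve_deriv X t + sqrt \<mu> *\<^sub>R (X t - xs) + \<Delta>2 *\<^sub>R gradient f (X t)))\<^sup>2)"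

definition rate_const :: "real \<Rightarrow> real \<Rightarrow> real \<Rightarrow> real" where
  "rate_const \<mu> \<Delta>1 \<Delta>2 =
     Min {2 * \<mu> * \<Delta>2 / (1 + \<Delta>1 + 3 * \<mu> * \<Delta>2\<^sup>2) * (\<Delta>1 - sqrt \<mu> / 2 * \<Delta>2),
          sqrt \<mu> / 3,
          sqrt \<mu> / 3 * \<Delta>1}"

end

theory Submission
  imports Defs
begin

text \<open>
  Write \<open>s = sqrt \<mu>\<close>, \<open>x = X - x\<^sup>*\<close>, \<open>v = X'\<close>, \<open>g = \<nabla>f(X)\<close>, \<open>F = f(X) - f(x\<^sup>*)\<close> and
  \<open>w = v + s x + \<Delta>\<^sub>2 g\<close>. The energy contains \<open>\<Delta>\<^sub>2 g\<close> inside the square because the chain rule then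
  produces exactly the Hessian term of the equation of motion, so that \<open>w' = - s v - (1 + \<Delta>\<^sub>1) g\<close>
  is free of second derivatives. Differentiating the energy and completing the square in \<open>v\<close>
  gives
  \<open>e\<^bsup>-st\<^esup> E' = s (1 + \<Delta>\<^sub>1) (F - g \<bullet> x) - (1 + \<Delta>\<^sub>1) \<Delta>\<^sub>2 |g|\<^sup>2 + s/2 |s x + \<Delta>\<^sub>2 g|\<^sup>2 - s/2 |v|\<^sup>2\<close>.

  Strong convexity bounds \<open>F - g \<bullet> x\<close> by \<open>- \<mu>/2 |x|\<^sup>2\<close>, and it also gives \<open>\<mu> (g \<bullet> x) \<le> |g|\<^sup>2\<close>, so
  one copy of \<open>\<Delta>\<^sub>2 |g|\<^sup>2\<close> absorbs the cross term \<open>\<mu> \<Delta>\<^sub>2 (g \<bullet> x)\<close> of the square. What is left is at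
  most \<open>- \<Delta>\<^sub>2 (\<Delta>\<^sub>1 - s \<Delta>\<^sub>2/2) |g|\<^sup>2 - s \<mu> \<Delta>\<^sub>1/2 |x|\<^sup>2 - s/2 |v|\<^sup>2\<close>. On the other side
  \<open>F \<le> |g|\<^sup>2/(2\<mu>)\<close> and \<open>|w|\<^sup>2 \<le> 3 (|v|\<^sup>2 + \<mu> |x|\<^sup>2 + \<Delta>\<^sub>2\<^sup>2 |g|\<^sup>2)\<close> bound the energy by the same three
  squares, and comparing their coefficients produces the three entries of the minimum defining
  \<open>c\<^sub>1\<close> (lemma \<open>lyapunov_decay_inequality\<close>). The decay of \<open>E\<close>, hence of \<open>F\<close>, follows by
  Gronwall's argument.
\<close>

section \<open>Gradients and Hessians\<close>

lemma gradient_eqI: "GDERIV f x :> g \<Longrightarrow> gradient f x = g"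
  unfolding gradient_def
proof (rule the_equality)
  fix h assume "GDERIV f x :> g" and "GDERIV f x :> h"
  then have "(\<lambda>u. u \<bullet> g) = (\<lambda>u. u \<bullet> h)"
    unfolding gderiv_def by (rule has_derivative_unique)
  then have "(h - g) \<bullet> g = (h - g) \<bullet> h" by (rule fun_cong)
  then have "(h - g) \<bullet> (h - g) = 0" by (simp only: inner_diff_right diff_self)
  then show "h = g" by simp
qed

lemma GDERIV_gradient:
  assumes "continuously_differentiable f"
  shows "GDERIV f x :> gradient f x"
  using assms gradient_eqI unfolding continuously_differentiable_def by metis

lemma gradient_has_derivative_hessian:
  assumes "gradient f differentiable (at x)"
  shows "(gradient f has_derivative blinfun_apply (hessian f x)) (at x)"
proof -
  obtain h where h: "(gradient f has_derivative h) (at x)"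
    using assms unfolding differentiable_def by blast
  then have "blinfun_apply (Blinfun h) = h"
    by (simp add: bounded_linear_Blinfun_apply has_derivative_bounded_linear)
  with h have "\<exists>!H. (gradient f has_derivative blinfun_apply H) (at x)"
    by (metis has_derivative_unique blinfun_apply_inject)
  then show ?thesis unfolding hessian_def by (rule theI')
qed

lemma gradient_zero_at_minimizer:
  assumes "continuously_differentiable f" and "is_arg_min f (\<lambda>_. True) xs"
  shows "gradient f xs = 0"
proof -
  have "(f has_derivative (\<lambda>h. h \<bullet> gradient f xs)) (at xs)"
    using GDERIV_gradient[OF assms(1)] unfolding gderiv_def .
  then have "(\<lambda>h. h \<bullet> gradient f xs) = (\<lambda>h. 0)"
    by (intro differential_zero_maxmin[of xs UNIV f])
       (use assms(2) in \<open>auto simp: is_arg_min_linorder\<close>)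
  then show ?thesis by (metis inner_eq_zero_iff)
qed

lemma strongly_convex_at_minimizer:
  assumes sc: "strongly_convex \<mu> f" and min: "is_arg_min f (\<lambda>_. True) xs"
  shows "f y - f xs + \<mu> / 2 * (norm (y - xs))\<^sup>2 \<le> gradient f y \<bullet> (y - xs)"
    and "\<mu> / 2 * (norm (y - xs))\<^sup>2 \<le> f y - f xs"
proof -
  have ineq: "f b - f a \<ge> gradient f a \<bullet> (b - a) + \<mu> / 2 * (norm (b - a))\<^sup>2" for a b
    using sc unfolding strongly_convex_def by blast
  have "gradient f y \<bullet> (xs - y) = - (gradient f y \<bullet> (y - xs))"
    by (metis inner_minus_right minus_diff_eq)
  then show "f y - f xs + \<mu> / 2 * (norm (y - xs))\<^sup>2 \<le> gradient f y \<bullet> (y - xs)"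
    using ineq[of y xs] by (simp add: norm_minus_commute)
  have "gradient f xs = 0"
    using gradient_zero_at_minimizer sc min unfolding strongly_convex_def by blast
  then show "\<mu> / 2 * (norm (y - xs))\<^sup>2 \<le> f y - f xs"
    using ineq[of xs y] by simp
qed

section \<open>The pointwise Lyapunov inequality\<close>

lemma norm_sum3_sq_le:
  fixes a b c :: "'a::real_inner"
  shows "(norm (a + b + c))\<^sup>2 \<le> 3 * ((norm a)\<^sup>2 + (norm b)\<^sup>2 + (norm c)\<^sup>2)"
proof -
  have "0 \<le> (norm (a - b))\<^sup>2 + (norm (b - c))\<^sup>2 + (norm (a - c))\<^sup>2" by simp
  then show ?thesis
    by (simp add: power2_norm_eq_inner inner_add_left inner_add_right inner_diff_left
        inner_diff_right inner_commute)
qed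

text \<open>
  Here \<open>g\<close> stands for the gradient at displacement \<open>x\<close> from the minimizer and \<open>F\<close> for the excess value;
  \<open>low\<close> and \<open>grad\<close> are the two consequences of strong convexity at the minimizer. The
  first conclusion is the Polyak-Lojasiewicz inequality; the second is a form of
  \<open>\<mu> |x| \<le> |g|\<close>. Both come from expanding \<open>|g - \<mu> x|\<^sup>2 \<ge> 0\<close>.
\<close>
lemma strongly_convex_gradient_dominance:
  fixes g x :: "'a::real_inner"
  assumes mu: "\<mu> > 0"
    and grad: "F + \<mu> / 2 * (norm x)\<^sup>2 \<le> g \<bullet> x"
    and low: "\<mu> / 2 * (norm x)\<^sup>2 \<le> F"
  shows "2 * \<mu> * F \<le> (norm g)\<^sup>2" and "\<mu> * (g \<bullet> x) \<le> (norm g)\<^sup>2"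
proof -
  have sq: "0 \<le> (norm g)\<^sup>2 - 2 * (\<mu> * (g \<bullet> x)) + \<mu> * (\<mu> * (norm x)\<^sup>2)"
    using zero_le_power2[of "norm (g - \<mu> *\<^sub>R x)"]
    by (simp add: power2_norm_eq_inner inner_diff_left inner_diff_right inner_commute algebra_simps)
  have "\<mu> * (F + \<mu> / 2 * (norm x)\<^sup>2) \<le> \<mu> * (g \<bullet> x)"
    using grad mu by (intro mult_left_mono) auto
  then show "2 * \<mu> * F \<le> (norm g)\<^sup>2"
    using sq by (simp add: algebra_simps)
  have "\<mu> * (\<mu> * (norm x)\<^sup>2) \<le> \<mu> * (g \<bullet> x)"
    using grad low mu by (intro mult_left_mono) auto
  then show "\<mu> * (g \<bullet> x) \<le> (norm g)\<^sup>2"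
    using sq by linarith
qed

text \<open>
  The left-hand side is the time derivative of the energy without its exponential factor, after
  the equation of motion has replaced \<open>w'\<close> by \<open>- s v - (1 + a) g\<close>. The three bounds on \<open>c\<close> are what
  the coefficients of \<open>|g|\<^sup>2\<close>, \<open>|v|\<^sup>2\<close> and \<open>|x|\<^sup>2\<close> require, in this order; the first is stated
  with its denominator cleared.
\<close>
lemma lyapunov_decay_inequality:
  fixes g x v :: "'a::real_inner" and s d :: real
  defines "w \<equiv> v + s *\<^sub>R x + d *\<^sub>R g"
  assumes s: "s > 0" and d: "d \<ge> 0" and a: "a \<ge> 0" and c: "c \<ge> 0"
    and grad: "F + s\<^sup>2 / 2 * (norm x)\<^sup>2 \<le> g \<bullet> x"
    and low: "s\<^sup>2 / 2 * (norm x)\<^sup>2 \<le> F"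
    and c_grad: "c * (1 + a + 3 * s\<^sup>2 * d\<^sup>2) \<le> 2 * s\<^sup>2 * d * (a - s / 2 * d)"
    and c_vel: "c \<le> s / 3" and c_pos: "c \<le> s / 3 * a"
  shows "s * ((1 + a) * F + 1 / 2 * (norm w)\<^sup>2)
      + ((1 + a) * (g \<bullet> v) + w \<bullet> (- s *\<^sub>R v - (1 + a) *\<^sub>R g))
    \<le> - c * ((1 + a) * F + 1 / 2 * (norm w)\<^sup>2)"
    (is "?L \<le> - c * ?E")
proof -
  define V Q G P where "V = (norm v)\<^sup>2" and "Q = (norm x)\<^sup>2" and "G = (norm g)\<^sup>2" and "P = g \<bullet> x"
  note dom = strongly_convex_gradient_dominance[OF _ grad low, folded G_def P_def]
  have nonneg: "V \<ge> 0" "Q \<ge> 0" "G \<ge> 0" by (auto simp: V_def Q_def G_def)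
  have L: "?L = s * (1 + a) * (F - P) - (1 + a) * d * G - s / 2 * V
      + (s * s\<^sup>2 / 2 * Q + s\<^sup>2 * d * P + s / 2 * d\<^sup>2 * G)"
    unfolding w_def V_def Q_def G_def P_def power2_norm_eq_inner
    by (simp only: inner_add_left inner_add_right inner_diff_right inner_scaleR_left
        inner_scaleR_right inner_commute[of v g] inner_commute[of x g] inner_commute[of x v])
       (simp add: algebra_simps power2_eq_square)

  \<comment> \<open>The part \<open>- d |g|\<^sup>2\<close> of the gradient term pays for the cross term \<open>s\<^sup>2 d P\<close>.\<close>
  have "?L \<le> - d * (a - s / 2 * d) * G - s / 2 * a * s\<^sup>2 * Q - s / 2 * V"
  proof -
    have "s * (1 + a) * (F - P) \<le> s * (1 + a) * (- (s\<^sup>2 / 2 * Q))"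
      using grad s a unfolding P_def Q_def by (intro mult_left_mono) auto
    moreover have "d * (s\<^sup>2 * P) \<le> d * G"
      using dom(2) s d by (intro mult_left_mono) auto
    moreover have "(- d * (a - s / 2 * d) * G - s / 2 * a * s\<^sup>2 * Q - s / 2 * V) - ?L
        = (s * (1 + a) * (- (s\<^sup>2 / 2 * Q)) - s * (1 + a) * (F - P)) + (d * G - d * (s\<^sup>2 * P))"
      unfolding L by (simp add: algebra_simps power2_eq_square)
    ultimately show ?thesis by linarith
  qed
  moreover have "c * ?E \<le> d * (a - s / 2 * d) * G + s / 2 * a * s\<^sup>2 * Q + s / 2 * V"
  proof -
    have "(norm w)\<^sup>2 \<le> 3 * (V + s\<^sup>2 * Q + d\<^sup>2 * G)"
      using norm_sum3_sq_le[of v "s *\<^sub>R x" "d *\<^sub>R g"]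
      by (simp add: w_def V_def Q_def G_def power_mult_distrib)
    moreover have F_le: "F \<le> G / (2 * s\<^sup>2)"
      using dom(1) s by (simp add: field_simps)
    then have "(1 + a) * F \<le> (1 + a) * (G / (2 * s\<^sup>2))"
      using a by (intro mult_left_mono) auto
    ultimately have "?E \<le> (1 + a) * (G / (2 * s\<^sup>2)) + 3 / 2 * (V + s\<^sup>2 * Q + d\<^sup>2 * G)"
      by linarith
    then have "c * ?E \<le> c * ((1 + a) * (G / (2 * s\<^sup>2)) + 3 / 2 * (V + s\<^sup>2 * Q + d\<^sup>2 * G))"
      using c by (rule mult_left_mono)
    also have "\<dots> = c * (1 + a + 3 * s\<^sup>2 * d\<^sup>2) / (2 * s\<^sup>2) * G + 3 / 2 * c * s\<^sup>2 * Q + 3 / 2 * c * V"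
      using s by (simp add: field_simps)
    also have "\<dots> \<le> d * (a - s / 2 * d) * G + s / 2 * a * s\<^sup>2 * Q + s / 2 * V"
    proof (intro add_mono mult_right_mono nonneg)
      show "c * (1 + a + 3 * s\<^sup>2 * d\<^sup>2) / (2 * s\<^sup>2) \<le> d * (a - s / 2 * d)"
        using c_grad s by (simp add: divide_le_eq mult_ac)
    qed (use c_vel c_pos in auto)
    finally show ?thesis .
  qed
  ultimately show ?thesis by linarith
qed

section \<open>Decay along the flow\<close>

lemma curve_deriv_works:
  assumes "X differentiable (at t within {0..})"
  shows "(X has_vector_derivative curve_deriv X t) (at t within {0..})"
  using assms unfolding curve_deriv_def by (simp add: vector_derivative_works)

lemma has_real_derivative_half_norm_sq:
  fixes w :: "real \<Rightarrow> 'a::real_inner"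
  assumes "(w has_vector_derivative w') (at t within S)"
  shows "((\<lambda>t. 1 / 2 * (norm (w t))\<^sup>2) has_real_derivative w t \<bullet> w') (at t within S)"
proof -
  have "((\<lambda>t. w t \<bullet> w t) has_vector_derivative (w t \<bullet> w' + w' \<bullet> w t)) (at t within S)"
    by (rule bounded_bilinear.has_vector_derivative[OF bounded_bilinear_inner assms assms])
  then have "((\<lambda>t. 1 / 2 * (w t \<bullet> w t)) has_real_derivative 1 / 2 * (w t \<bullet> w' + w' \<bullet> w t)) (at t within S)"
    unfolding has_real_derivative_iff_has_vector_derivative[symmetric] by (rule DERIV_cmult)
  then show ?thesis by (simp add: power2_norm_eq_inner inner_commute)
qed

lemma has_real_derivative_along_curve:
  fixes X :: "real \<Rightarrow> 'a::real_inner"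
  assumes f: "GDERIV f (X t) :> g" and X: "(X has_vector_derivative v) (at t within S)"
  shows "((\<lambda>t. f (X t)) has_real_derivative g \<bullet> v) (at t within S)"
proof -
  have "((\<lambda>t. f (X t)) has_derivative (\<lambda>h. (h *\<^sub>R v) \<bullet> g)) (at t within S)"
    using has_derivative_compose[OF X[unfolded has_vector_derivative_def] f[unfolded gderiv_def]] .
  then show ?thesis
    unfolding has_field_derivative_def
    by (rule has_derivative_eq_rhs) (auto simp: inner_commute mult.commute)
qed

text \<open>
  The Hessian damping of the equation of motion is the derivative of \<open>\<Delta>2 *\<^sub>R gradient f (X t)\<close>
  and cancels against it, so \<open>w'\<close> contains neither the acceleration nor the Hessian.
\<close>
lemma energy_has_derivative:
  fixes f :: "'a::real_inner \<Rightarrow> real" and xs :: 'a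
  assumes C2: "twice_continuously_differentiable f"
    and sol: "hessian_damped_solution \<mu> \<Delta>1 \<Delta>2 f X" and t: "t \<ge> 0"
  defines "s \<equiv> sqrt \<mu>" and "v \<equiv> curve_deriv X t" and "g \<equiv> gradient f (X t)"
  defines "w \<equiv> v + s *\<^sub>R (X t - xs) + \<Delta>2 *\<^sub>R g"
  shows "(energy \<mu> \<Delta>1 \<Delta>2 f xs X has_real_derivative
     exp (s * t) * (s * ((1 + \<Delta>1) * (f (X t) - f xs) + 1 / 2 * (norm w)\<^sup>2)
       + ((1 + \<Delta>1) * (g \<bullet> v) + w \<bullet> (- s *\<^sub>R v - (1 + \<Delta>1) *\<^sub>R g)))) (at t within {0..})"
proof -
  have C1: "continuously_differentiable f" and diff: "gradient f differentiable (at (X t))"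
    using C2 unfolding twice_continuously_differentiable_def by auto
  define acc where "acc = curve_deriv (curve_deriv X) t"
  define Hv where "Hv = blinfun_apply (hessian f (X t)) v"
  have X': "(X has_vector_derivative v) (at t within {0..})"
    and v': "(curve_deriv X has_vector_derivative acc) (at t within {0..})"
    using sol t unfolding hessian_damped_solution_def v_def acc_def
    by (auto intro: curve_deriv_works)
  have ode: "acc + (2 * s) *\<^sub>R v + (1 + \<Delta>1) *\<^sub>R g + \<Delta>2 *\<^sub>R Hv = 0"
    using sol t unfolding hessian_damped_solution_def acc_def Hv_def v_def s_def g_def by auto
  have f': "((\<lambda>t. f (X t)) has_real_derivative g \<bullet> v) (at t within {0..})"
    using has_real_derivative_along_curve[OF GDERIV_gradient[OF C1] X'] unfolding g_def .
  have "(((gradient f) \<circ> X) has_vector_derivative Hv) (at t within {0..})"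
    unfolding Hv_def
    by (rule vector_derivative_diff_chain_within[OF X'])
       (rule has_derivative_at_withinI[OF gradient_has_derivative_hessian[OF diff]])
  then have g': "((\<lambda>t. gradient f (X t)) has_vector_derivative Hv) (at t within {0..})"
    by (simp add: o_def)
  define W where "W = (\<lambda>t. curve_deriv X t + s *\<^sub>R (X t - xs) + \<Delta>2 *\<^sub>R gradient f (X t))"
  have "(W has_vector_derivative (acc + s *\<^sub>R v + \<Delta>2 *\<^sub>R Hv)) (at t within {0..})"
    unfolding W_def using X' v' g' by (auto intro!: derivative_eq_intros)
  moreover have "acc + s *\<^sub>R v + \<Delta>2 *\<^sub>R Hv = - s *\<^sub>R v - (1 + \<Delta>1) *\<^sub>R g"
  proof -
    have "acc + s *\<^sub>R v + \<Delta>2 *\<^sub>R Hv - (- s *\<^sub>R v - (1 + \<Delta>1) *\<^sub>R g)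
        = acc + (2 * s) *\<^sub>R v + (1 + \<Delta>1) *\<^sub>R g + \<Delta>2 *\<^sub>R Hv"
      by (simp add: algebra_simps flip: scaleR_2)
    then show ?thesis using ode by simp
  qed
  ultimately have W': "(W has_vector_derivative (- s *\<^sub>R v - (1 + \<Delta>1) *\<^sub>R g)) (at t within {0..})"
    by simp
  have "energy \<mu> \<Delta>1 \<Delta>2 f xs X
      = (\<lambda>t. exp (s * t) * ((1 + \<Delta>1) * (f (X t) - f xs) + 1 / 2 * (norm (W t))\<^sup>2))"
    by (simp add: fun_eq_iff energy_def W_def s_def)
  moreover have "W t = w"
    by (simp add: W_def w_def v_def g_def)
  moreover have base: "((\<lambda>t. (1 + \<Delta>1) * (f (X t) - f xs) + 1 / 2 * (norm (W t))\<^sup>2) has_real_derivative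
      ((1 + \<Delta>1) * (g \<bullet> v) + W t \<bullet> (- s *\<^sub>R v - (1 + \<Delta>1) *\<^sub>R g))) (at t within {0..})"
    using f' by (intro DERIV_add[OF _ has_real_derivative_half_norm_sq[OF W']])
      (auto intro!: derivative_eq_intros)
  moreover have expo: "((\<lambda>t. exp (s * t)) has_real_derivative exp (s * t) * s) (at t within {0..})"
    by (auto intro!: derivative_eq_intros)
  ultimately show ?thesis
    using DERIV_mult[OF expo base] by (simp only: algebra_simps)
qed

text \<open>Gronwall's argument: \<open>exp (c * t) * E t\<close> is nonincreasing.\<close>
lemma exponential_decay_of_derivative_le:
  fixes E :: "real \<Rightarrow> real"
  assumes E': "\<And>t. t \<ge> 0 \<Longrightarrow> \<exists>D. (E has_real_derivative D) (at t within {0..}) \<and> D \<le> - c * E t"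
    and t: "t \<ge> 0"
  shows "E t \<le> exp (- c * t) * E 0"
proof -
  have "exp (c * t) * E t \<le> exp (c * 0) * E 0"
  proof (rule DERIV_nonpos_imp_decreasing_open[OF t])
    show "\<exists>y. ((\<lambda>t. exp (c * t) * E t) has_real_derivative y) (at u) \<and> y \<le> 0"
      if "0 < u" "u < t" for u
    proof -
      obtain D where "(E has_real_derivative D) (at u within {0..})" and D: "D \<le> - c * E u"
        using E'[of u] \<open>0 < u\<close> by auto
      moreover have "at u within {0..} = at u"
        using that by (intro at_within_interior) simp
      ultimately have "((\<lambda>t. exp (c * t) * E t) has_real_derivative exp (c * u) * (c * E u + D)) (at u)"
        by (auto intro!: derivative_eq_intros simp: algebra_simps)
      moreover have "exp (c * u) * (c * E u + D) \<le> 0"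
        using D by (intro mult_nonneg_nonpos) auto
      ultimately show ?thesis by blast
    qed
    have "continuous_on {0..} E"
      unfolding continuous_on_eq_continuous_within
      using E' by (meson DERIV_continuous atLeast_iff)
    then show "continuous_on {0..t} (\<lambda>t. exp (c * t) * E t)"
      by (intro continuous_intros) (auto elim: continuous_on_subset)
  qed
  then have "exp (- c * t) * (exp (c * t) * E t) \<le> exp (- c * t) * E 0"
    by (intro mult_left_mono) auto
  then show ?thesis
    by (simp add: mult.assoc[symmetric] flip: exp_add)
qed

lemma rate_const_pos:
  assumes "\<mu> > 0" "0 < sqrt \<mu> / 2 * \<Delta>2" "sqrt \<mu> / 2 * \<Delta>2 < \<Delta>1"
  shows "rate_const \<mu> \<Delta>1 \<Delta>2 > 0"
proof -
  have "\<Delta>2 > 0" using assms(1,2) by (simp add: zero_less_mult_iff)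
  moreover have "\<Delta>1 > 0" using assms by linarith
  moreover have "1 + \<Delta>1 + 3 * \<mu> * \<Delta>2\<^sup>2 > 0"
    using assms(1) \<open>\<Delta>1 > 0\<close> by (intro add_pos_nonneg) auto
  ultimately show ?thesis
    using assms \<open>\<Delta>1 > 0\<close> unfolding rate_const_def by simp
qed

text \<open>
  The last claim drops the square from \<open>E t\<close>, whose remaining summand is
  \<open>exp (sqrt \<mu> * t) * (1 + \<Delta>1)\<close> times the gap in function value.
\<close>
theorem theorem2:
  fixes f :: "'a::real_inner \<Rightarrow> real" and X :: "real \<Rightarrow> 'a" and xs :: 'a
    and \<mu> \<Delta>1 \<Delta>2 :: real
  assumes finite_dim: "\<exists>B :: 'a set. finite B \<and> span B = UNIV"
    and C2: "twice_continuously_differentiable f"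
    and mu_pos: "\<mu> > 0"
    and strongly_convex: "strongly_convex \<mu> f"
    and minimizer: "is_arg_min f (\<lambda>_. True) xs"
    and Delta_pos: "0 < sqrt \<mu> / 2 * \<Delta>2"
    and Delta_less: "sqrt \<mu> / 2 * \<Delta>2 < \<Delta>1"
    and solution: "hessian_damped_solution \<mu> \<Delta>1 \<Delta>2 f X"
  defines "c1 \<equiv> rate_const \<mu> \<Delta>1 \<Delta>2"
    and "E \<equiv> energy \<mu> \<Delta>1 \<Delta>2 f xs X"
  shows "(\<forall>t\<ge>0. \<exists>D. (E has_real_derivative D) (at t within {0..}) \<and> D \<le> - c1 * E t)
    \<and> c1 > 0
    \<and> (\<forall>t\<ge>0. f (X t) - f xs \<le> 1 / (1 + \<Delta>1) * exp (- (sqrt \<mu> + c1) * t) * E 0)"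
proof -
  define s where "s = sqrt \<mu>"
  have s: "s > 0" and s2: "s\<^sup>2 = \<mu>" using mu_pos by (auto simp: s_def)
  have d: "\<Delta>2 > 0" using Delta_pos mu_pos by (simp add: zero_less_mult_iff)
  have a: "\<Delta>1 > 0" using Delta_pos Delta_less by linarith
  have c_pos: "c1 > 0" unfolding c1_def by (rule rate_const_pos) fact+
  have "1 + \<Delta>1 + 3 * s\<^sup>2 * \<Delta>2\<^sup>2 > 0"
    using a by (intro add_pos_nonneg) auto
  moreover have "c1 \<le> 2 * s\<^sup>2 * \<Delta>2 / (1 + \<Delta>1 + 3 * s\<^sup>2 * \<Delta>2\<^sup>2) * (\<Delta>1 - s / 2 * \<Delta>2)"
    unfolding s2 by (simp add: c1_def rate_const_def s_def)
  ultimately have c_grad: "c1 * (1 + \<Delta>1 + 3 * s\<^sup>2 * \<Delta>2\<^sup>2) \<le> 2 * s\<^sup>2 * \<Delta>2 * (\<Delta>1 - s / 2 * \<Delta>2)"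
    by (simp add: pos_le_divide_eq)
  have c_bounds: "c1 \<le> s / 3" "c1 \<le> s / 3 * \<Delta>1"
    unfolding c1_def rate_const_def s_def by (rule Min_le; simp)+

  have decay: "\<exists>D. (E has_real_derivative D) (at t within {0..}) \<and> D \<le> - c1 * E t"
    if t: "t \<ge> 0" for t
  proof (intro exI conjI)
    define x v g where "x = X t - xs" and "v = curve_deriv X t" and "g = gradient f (X t)"
    define B where "B = (1 + \<Delta>1) * (f (X t) - f xs) + 1 / 2 * (norm (v + s *\<^sub>R x + \<Delta>2 *\<^sub>R g))\<^sup>2"
    define L where "L = s * B + ((1 + \<Delta>1) * (g \<bullet> v)
        + (v + s *\<^sub>R x + \<Delta>2 *\<^sub>R g) \<bullet> (- s *\<^sub>R v - (1 + \<Delta>1) *\<^sub>R g))"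
    show "(E has_real_derivative exp (s * t) * L) (at t within {0..})"
      using energy_has_derivative[OF C2 solution t, of xs]
      unfolding E_def L_def B_def x_def v_def g_def s_def .
    have "L \<le> - c1 * B"
      unfolding L_def B_def
    proof (rule lyapunov_decay_inequality)
      show "f (X t) - f xs + s\<^sup>2 / 2 * (norm x)\<^sup>2 \<le> g \<bullet> x"
        and "s\<^sup>2 / 2 * (norm x)\<^sup>2 \<le> f (X t) - f xs"
        unfolding s2 x_def g_def
        using strongly_convex_at_minimizer[OF strongly_convex minimizer] by auto
    qed (use s d a c_pos c_grad c_bounds in auto)
    then have "exp (s * t) * L \<le> exp (s * t) * (- c1 * B)"
      by (intro mult_left_mono) auto
    also have "\<dots> = - c1 * E t"
      by (simp add: E_def energy_def B_def x_def v_def g_def s_def)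
    finally show "exp (s * t) * L \<le> - c1 * E t" .
  qed

  have "f (X t) - f xs \<le> 1 / (1 + \<Delta>1) * exp (- (sqrt \<mu> + c1) * t) * E 0" if t: "t \<ge> 0" for t
  proof -
    have "exp (s * t) * ((1 + \<Delta>1) * (f (X t) - f xs)) \<le> E t"
      unfolding E_def energy_def s_def by (intro mult_left_mono) auto
    also have "\<dots> \<le> exp (- c1 * t) * E 0"
      using decay t by (rule exponential_decay_of_derivative_le)
    finally have "exp (- s * t) * (exp (s * t) * ((1 + \<Delta>1) * (f (X t) - f xs)))
        \<le> exp (- s * t) * (exp (- c1 * t) * E 0)"
      by (intro mult_left_mono) auto
    moreover have "exp (- s * t) * exp (s * t) = 1"
      by (simp flip: exp_add)
    moreover have "exp (- (s + c1) * t) = exp (- s * t) * exp (- c1 * t)"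
      by (simp add: algebra_simps flip: exp_add)
    ultimately have "(1 + \<Delta>1) * (f (X t) - f xs) \<le> exp (- (s + c1) * t) * E 0"
      by (simp only: mult.assoc[symmetric] mult_1_left)
    then show ?thesis
      using a by (simp add: s_def field_simps)
  qed
  with decay c_pos show ?thesis by blast
qed

end
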